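(* There exist regular $\neg$-decreasing total orderings of $Sen(L)$, and hence regular $\neg$-decreasing choice functions for $L$ (namely $\min_<$ for such an ordering $<$).
   Context: $L$ is the classical propositional language with atoms $p_0,p_1,\ldots$ and connectives $\neg,\wedge$; $\sim$ is classical equivalence on $Sen(L)$, $[\alpha]=\{\beta:\beta\sim\alpha\}$. A total ordering $<$ of $Sen(L)$ is regular if $\alpha\not\sim\beta$ and $\alpha<\beta$ imply $\alpha'<\beta'$ for all $\alpha'\in[\alpha],\beta'\in[\beta]$; it is $\neg$-decreasing if for all $\alpha\not\sim\beta$: $\alpha<\beta\iff\neg\beta<\neg\alpha$. A choice function for $L$ assigns to each $\{\alpha,\beta\}\subseteq Sen(L)$ an element of $\{\alpha,\beta\}$. The Axiom of Choice is assumed. *)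

theory Defs
  imports Main
begin

datatype sen = Atom nat | Neg sen | Conj sen sen

primrec holds :: "(nat \<Rightarrow> bool) \<Rightarrow> sen \<Rightarrow> bool" where
  "holds v (Atom n) \<longleftrightarrow> v n"
| "holds v (Neg \<alpha>) \<longleftrightarrow> \<not> holds v \<alpha>"
| "holds v (Conj \<alpha> \<beta>) \<longleftrightarrow> holds v \<alpha> \<and> holds v \<beta>"

definition sen_equiv :: "sen \<Rightarrow> sen \<Rightarrow> bool" (infix "\<sim>" 50) where
  "\<alpha> \<sim> \<beta> \<longleftrightarrow> (\<forall>v. holds v \<alpha> \<longleftrightarrow> holds v \<beta>)"

abbreviation not_sen_equiv :: "sen \<Rightarrow> sen \<Rightarrow> bool" (infix "\<nsim>" 50) where
  "\<alpha> \<nsim> \<beta> \<equiv> \<not> \<alpha> \<sim> \<beta>"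

definition sen_class :: "sen \<Rightarrow> sen set" where
  "sen_class \<alpha> = {\<beta>. \<beta> \<sim> \<alpha>}"

text \<open>
  A total ordering is given by its strict part, a relation \<open>r\<close> with
  \<open>strict_linear_order_on UNIV r\<close>; \<open>(\<alpha>, \<beta>) \<in> r\<close> stands for \<open>\<alpha> < \<beta>\<close>.
\<close>

definition regular_ordering :: "sen rel \<Rightarrow> bool" where
  "regular_ordering r \<longleftrightarrow>
     (\<forall>\<alpha> \<beta>. \<alpha> \<nsim> \<beta> \<and> (\<alpha>, \<beta>) \<in> r \<longrightarrow>
        (\<forall>\<alpha>' \<in> sen_class \<alpha>. \<forall>\<beta>' \<in> sen_class \<beta>. (\<alpha>', \<beta>') \<in> r))"

definition neg_decreasing_ordering :: "sen rel \<Rightarrow> bool" where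
  "neg_decreasing_ordering r \<longleftrightarrow>
     (\<forall>\<alpha> \<beta>. \<alpha> \<nsim> \<beta> \<longrightarrow> ((\<alpha>, \<beta>) \<in> r \<longleftrightarrow> (Neg \<beta>, Neg \<alpha>) \<in> r))"

text \<open>
  A choice function acts on unordered pairs \<open>{\<alpha>, \<beta>}\<close>, singletons included.
  Its values on all other sets are irrelevant.
\<close>

definition choice_function :: "(sen set \<Rightarrow> sen) \<Rightarrow> bool" where
  "choice_function f \<longleftrightarrow> (\<forall>\<alpha> \<beta>. f {\<alpha>, \<beta>} \<in> {\<alpha>, \<beta>})"

definition regular_choice :: "(sen set \<Rightarrow> sen) \<Rightarrow> bool" where
  "regular_choice f \<longleftrightarrow>
     (\<forall>\<alpha> \<alpha>' \<beta>. \<alpha> \<sim> \<alpha>' \<longrightarrow> f {\<alpha>, \<beta>} \<sim> f {\<alpha>', \<beta>})"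

definition neg_decreasing_choice :: "(sen set \<Rightarrow> sen) \<Rightarrow> bool" where
  "neg_decreasing_choice f \<longleftrightarrow>
     (\<forall>\<alpha> \<beta>. \<alpha> \<nsim> \<beta> \<longrightarrow>
        (f {\<alpha>, \<beta>} = \<alpha> \<longleftrightarrow> f {Neg \<alpha>, Neg \<beta>} = Neg \<beta>))"

definition min_wrt :: "sen rel \<Rightarrow> sen set \<Rightarrow> sen" where
  "min_wrt r X = (THE \<alpha>. \<alpha> \<in> X \<and> (\<forall>\<beta> \<in> X. \<beta> \<noteq> \<alpha> \<longrightarrow> (\<alpha>, \<beta>) \<in> r))"

end

theory Submission
  imports Defs "HOL-Library.Countable"
begin

text \<open>
  Fix a valuation \<open>v\<close>. Exactly one of \<open>\<alpha>\<close>, \<open>\<not>\<alpha>\<close> holds under \<open>v\<close>, so numbering the classes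
  true under \<open>v\<close> by positive integers and giving \<open>[\<not>\<alpha>]\<close> the opposite of the number of
  \<open>[\<alpha>]\<close> ranks the classes injectively in such a way that negation reverses the ranking.
  Ties inside a class are broken by an enumeration of all sentences. Since \<open>Sen(L)\<close> is
  countable, integer ranks suffice.
\<close>

instance sen :: countable
  by countable_datatype

lemma sen_equiv_refl: "\<alpha> \<sim> \<alpha>"
  by (simp add: sen_equiv_def)

lemma sen_equiv_sym: "\<alpha> \<sim> \<beta> \<Longrightarrow> \<beta> \<sim> \<alpha>"
  by (simp add: sen_equiv_def)

lemma sen_equiv_trans: "\<alpha> \<sim> \<beta> \<Longrightarrow> \<beta> \<sim> \<gamma> \<Longrightarrow> \<alpha> \<sim> \<gamma>"
  by (simp add: sen_equiv_def)

lemma Neg_sen_equiv_Neg_iff: "Neg \<alpha> \<sim> Neg \<beta> \<longleftrightarrow> \<alpha> \<sim> \<beta>"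
  by (auto simp: sen_equiv_def)

lemma Neg_Neg_sen_equiv: "Neg (Neg \<alpha>) \<sim> \<alpha>"
  by (simp add: sen_equiv_def)

text \<open>The predicate under \<open>SOME\<close> is the same for all members of a class, so the
  choice yields one representative per class, and the code of that representative numbers the
  class.\<close>

definition class_index :: "sen \<Rightarrow> nat" where
  "class_index \<alpha> = to_nat (SOME \<beta>. \<beta> \<sim> \<alpha>)"

lemma class_index_eq_iff: "class_index \<alpha> = class_index \<beta> \<longleftrightarrow> \<alpha> \<sim> \<beta>"
proof
  assume "class_index \<alpha> = class_index \<beta>"
  then have "(SOME \<gamma>. \<gamma> \<sim> \<alpha>) = (SOME \<gamma>. \<gamma> \<sim> \<beta>)"
    by (simp add: class_index_def)
  moreover have "(SOME \<gamma>. \<gamma> \<sim> \<alpha>) \<sim> \<alpha>" "(SOME \<gamma>. \<gamma> \<sim> \<beta>) \<sim> \<beta>"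
    by (rule someI, rule sen_equiv_refl)+
  ultimately show "\<alpha> \<sim> \<beta>"
    by (metis sen_equiv_sym sen_equiv_trans)
next
  assume "\<alpha> \<sim> \<beta>"
  then have "(\<lambda>\<gamma>. \<gamma> \<sim> \<alpha>) = (\<lambda>\<gamma>. \<gamma> \<sim> \<beta>)"
    by (simp add: sen_equiv_def)
  then show "class_index \<alpha> = class_index \<beta>"
    by (simp add: class_index_def)
qed

text \<open>Class indices may be 0; the shift by 1 keeps ranks away from 0, so that a class and the
  class of its negation never share a rank. A sentence false under \<open>v\<close> borrows the
  index of its negation, which is true.\<close>

definition rank :: "(nat \<Rightarrow> bool) \<Rightarrow> sen \<Rightarrow> int" where
  "rank v \<alpha> = (if holds v \<alpha> then 1 + int (class_index \<alpha>) else - 1 - int (class_index (Neg \<alpha>)))"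

text \<open>Different truth values under \<open>v\<close> rule out equivalence and give ranks of
  opposite sign. With equal truth values only class indices are compared, either of the sentences or
  of their negations.\<close>

lemma rank_eq_iff: "rank v \<alpha> = rank v \<beta> \<longleftrightarrow> \<alpha> \<sim> \<beta>"
proof (cases "holds v \<alpha> \<longleftrightarrow> holds v \<beta>")
  case True
  then show ?thesis
    by (auto simp: rank_def class_index_eq_iff Neg_sen_equiv_Neg_iff)
next
  case False
  then have "\<alpha> \<nsim> \<beta>"
    by (auto simp: sen_equiv_def)
  with False show ?thesis
    by (auto simp: rank_def)
qed

lemma rank_Neg: "rank v (Neg \<alpha>) = - rank v \<alpha>"
proof -
  \<comment> \<open>Needed when \<alpha> is true: then \<open>Neg \<alpha>\<close> is false, and its
    rank refers to the index of the double negation.\<close>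
  have "class_index (Neg (Neg \<alpha>)) = class_index \<alpha>"
    by (simp add: class_index_eq_iff Neg_Neg_sen_equiv)
  then show ?thesis
    by (simp add: rank_def)
qed

definition rank_ordering :: "(nat \<Rightarrow> bool) \<Rightarrow> sen rel" where
  "rank_ordering v =
     {(\<alpha>, \<beta>). rank v \<alpha> < rank v \<beta> \<or> rank v \<alpha> = rank v \<beta> \<and> to_nat \<alpha> < to_nat \<beta>}"

text \<open>Inequivalent sentences have different ranks, so the tie-break never decides between
  them. Regularity and the behaviour under negation thus become statements about ranks
  alone.\<close>

lemma rank_ordering_iff:
  "\<alpha> \<nsim> \<beta> \<Longrightarrow> (\<alpha>, \<beta>) \<in> rank_ordering v \<longleftrightarrow> rank v \<alpha> < rank v \<beta>"
  by (simp add: rank_ordering_def rank_eq_iff)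

lemma strict_linear_order_rank_ordering: "strict_linear_order_on UNIV (rank_ordering v)"
  unfolding strict_linear_order_on_def
proof (intro conjI)
  show "trans (rank_ordering v)"
    by (rule transI) (auto simp: rank_ordering_def)
  show "irrefl (rank_ordering v)"
    by (simp add: irrefl_def rank_ordering_def)
  show "total (rank_ordering v)"
  proof (rule total_onI)
    fix \<alpha> \<beta> :: sen
    assume "\<alpha> \<noteq> \<beta>"
    then have "to_nat \<alpha> \<noteq> to_nat \<beta>"
      by simp
    then show "(\<alpha>, \<beta>) \<in> rank_ordering v \<or> (\<beta>, \<alpha>) \<in> rank_ordering v"
      unfolding rank_ordering_def mem_Collect_eq prod.case by linarith
  qed
qed

lemma regular_rank_ordering: "regular_ordering (rank_ordering v)"
  unfolding regular_ordering_def
proof (intro allI impI ballI, elim conjE)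
  fix \<alpha> \<beta> \<alpha>' \<beta>'
  assume "\<alpha> \<nsim> \<beta>" "(\<alpha>, \<beta>) \<in> rank_ordering v" "\<alpha>' \<in> sen_class \<alpha>" "\<beta>' \<in> sen_class \<beta>"
  then have "rank v \<alpha> < rank v \<beta>" "rank v \<alpha>' = rank v \<alpha>" "rank v \<beta>' = rank v \<beta>"
    by (simp_all add: rank_ordering_iff rank_eq_iff sen_class_def)
  then show "(\<alpha>', \<beta>') \<in> rank_ordering v"
    by (simp add: rank_ordering_def)
qed

lemma neg_decreasing_rank_ordering: "neg_decreasing_ordering (rank_ordering v)"
  unfolding neg_decreasing_ordering_def
proof (intro allI impI)
  fix \<alpha> \<beta>
  assume "\<alpha> \<nsim> \<beta>"
  moreover from this have "Neg \<beta> \<nsim> Neg \<alpha>"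
    by (auto simp: Neg_sen_equiv_Neg_iff dest: sen_equiv_sym)
  ultimately show "(\<alpha>, \<beta>) \<in> rank_ordering v \<longleftrightarrow> (Neg \<beta>, Neg \<alpha>) \<in> rank_ordering v"
    by (simp add: rank_ordering_iff rank_Neg)
qed

lemma strict_linear_order_swap_iff:
  assumes "strict_linear_order_on UNIV r" "\<alpha> \<noteq> \<beta>"
  shows "(\<alpha>, \<beta>) \<in> r \<longleftrightarrow> (\<beta>, \<alpha>) \<notin> r"
proof -
  have "(\<alpha>, \<beta>) \<in> r \<or> (\<beta>, \<alpha>) \<in> r"
    using assms by (simp add: strict_linear_order_on_def total_on_def)
  moreover have "\<not> ((\<alpha>, \<beta>) \<in> r \<and> (\<beta>, \<alpha>) \<in> r)"
    using assms(1) by (auto simp: strict_linear_order_on_def irrefl_def dest: transD)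
  ultimately show ?thesis
    by blast
qed

text \<open>Replaces the definite description by a case distinction: for distinct elements exactly
  one of the two comparisons holds, which gives both existence and uniqueness of the
  minimum.\<close>

lemma min_wrt_pair:
  assumes "strict_linear_order_on UNIV r"
  shows "min_wrt r {\<alpha>, \<beta>} = (if \<alpha> = \<beta> \<or> (\<alpha>, \<beta>) \<in> r then \<alpha> else \<beta>)"
  unfolding min_wrt_def
proof (rule the_equality)
  show "(if \<alpha> = \<beta> \<or> (\<alpha>, \<beta>) \<in> r then \<alpha> else \<beta>) \<in> {\<alpha>, \<beta>} \<and>
    (\<forall>\<gamma>\<in>{\<alpha>, \<beta>}. \<gamma> \<noteq> (if \<alpha> = \<beta> \<or> (\<alpha>, \<beta>) \<in> r then \<alpha> else \<beta>) \<longrightarrow>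
      ((if \<alpha> = \<beta> \<or> (\<alpha>, \<beta>) \<in> r then \<alpha> else \<beta>), \<gamma>) \<in> r)"
    using strict_linear_order_swap_iff[OF assms, of \<alpha> \<beta>] by auto
next
  fix \<delta>
  assume "\<delta> \<in> {\<alpha>, \<beta>} \<and> (\<forall>\<gamma>\<in>{\<alpha>, \<beta>}. \<gamma> \<noteq> \<delta> \<longrightarrow> (\<delta>, \<gamma>) \<in> r)"
  then show "\<delta> = (if \<alpha> = \<beta> \<or> (\<alpha>, \<beta>) \<in> r then \<alpha> else \<beta>)"
    using strict_linear_order_swap_iff[OF assms, of \<alpha> \<beta>] by (cases "\<alpha> = \<beta>") auto
qed

lemma choice_function_min_wrt:
  assumes "strict_linear_order_on UNIV r"
  shows "choice_function (min_wrt r)"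
  by (simp add: choice_function_def min_wrt_pair[OF assms])

lemma regular_choice_min_wrt:
  assumes r: "strict_linear_order_on UNIV r" and reg: "regular_ordering r"
  shows "regular_choice (min_wrt r)"
  unfolding regular_choice_def
proof (intro allI impI)
  fix \<alpha> \<alpha>' \<beta>
  assume eq: "\<alpha> \<sim> \<alpha>'"
  show "min_wrt r {\<alpha>, \<beta>} \<sim> min_wrt r {\<alpha>', \<beta>}"
  proof (cases "\<alpha> \<sim> \<beta>")
    \<comment> \<open>All three sentences are equivalent here, so it does not matter which element
      is chosen from either pair.\<close>
    case True
    with eq show ?thesis
      by (simp add: min_wrt_pair[OF r] sen_equiv_def)
  next
    case False
    with eq have "\<alpha>' \<nsim> \<beta>"
      by (metis sen_equiv_trans)
    \<comment> \<open>Regularity is applied in both directions, moving from \<alpha> to \<alpha>'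
      and back with \<beta> fixed. Both pairs then yield \<beta>, or they yield \<alpha> and
      \<alpha>'.\<close>
    with False eq have "(\<alpha>, \<beta>) \<in> r \<longleftrightarrow> (\<alpha>', \<beta>) \<in> r"
      using reg unfolding regular_ordering_def sen_class_def
      by (metis mem_Collect_eq sen_equiv_refl sen_equiv_sym)
    moreover have "\<alpha> \<noteq> \<beta>" "\<alpha>' \<noteq> \<beta>"
      using False \<open>\<alpha>' \<nsim> \<beta>\<close> sen_equiv_refl by auto
    ultimately show ?thesis
      using eq by (simp add: min_wrt_pair[OF r] sen_equiv_refl)
  qed
qed

lemma neg_decreasing_choice_min_wrt:
  assumes r: "strict_linear_order_on UNIV r" and neg: "neg_decreasing_ordering r"
  shows "neg_decreasing_choice (min_wrt r)"
  unfolding neg_decreasing_choice_def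
proof (intro allI impI)
  fix \<alpha> \<beta>
  assume "\<alpha> \<nsim> \<beta>"
  then have ne: "\<alpha> \<noteq> \<beta>" and swap: "(\<alpha>, \<beta>) \<in> r \<longleftrightarrow> (Neg \<beta>, Neg \<alpha>) \<in> r"
    using neg sen_equiv_refl unfolding neg_decreasing_ordering_def by auto
  have "min_wrt r {\<alpha>, \<beta>} = \<alpha> \<longleftrightarrow> (\<alpha>, \<beta>) \<in> r"
    using ne by (simp add: min_wrt_pair[OF r])
  \<comment> \<open>\<open>Neg\<close> is injective, so the negations are distinct and exactly one
    of their two comparisons holds. The negated form matches the branch of
    \<open>min_wrt_pair\<close> that returns the second element.\<close>
  also have "\<dots> \<longleftrightarrow> (Neg \<alpha>, Neg \<beta>) \<notin> r"
    using swap strict_linear_order_swap_iff[OF r] ne by blast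
  also have "\<dots> \<longleftrightarrow> min_wrt r {Neg \<alpha>, Neg \<beta>} = Neg \<beta>"
    using ne by (simp add: min_wrt_pair[OF r])
  finally show "min_wrt r {\<alpha>, \<beta>} = \<alpha> \<longleftrightarrow> min_wrt r {Neg \<alpha>, Neg \<beta>} = Neg \<beta>" .
qed

theorem theorem2p43:
  shows "(\<exists>r. strict_linear_order_on UNIV r \<and> regular_ordering r \<and> neg_decreasing_ordering r)
    \<and> (\<forall>r. strict_linear_order_on UNIV r \<and> regular_ordering r \<and> neg_decreasing_ordering r \<longrightarrow>
          choice_function (min_wrt r) \<and> regular_choice (min_wrt r)
            \<and> neg_decreasing_choice (min_wrt r))
    \<and> (\<exists>f. choice_function f \<and> regular_choice f \<and> neg_decreasing_choice f)"
proof -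
  let ?good = "\<lambda>r. strict_linear_order_on UNIV r \<and> regular_ordering r \<and> neg_decreasing_ordering r"
  let ?choice = "\<lambda>f. choice_function f \<and> regular_choice f \<and> neg_decreasing_choice f"
  \<comment> \<open>Any valuation would serve; the constantly true one is a concrete choice.\<close>
  have ex: "?good (rank_ordering (\<lambda>_. True))"
    by (intro conjI strict_linear_order_rank_ordering regular_rank_ordering
        neg_decreasing_rank_ordering)
  have min: "?choice (min_wrt r)" if "?good r" for r
    using that
    by (elim conjE) (intro conjI choice_function_min_wrt regular_choice_min_wrt
        neg_decreasing_choice_min_wrt)
  show ?thesis
    using ex min min[OF ex] by (intro conjI[OF exI conjI[OF allI exI]] impI)
qed

end
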